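(* Let $(Q_{n,k})$ be a regular B-representable family of polynomials with orthogonal companion $Q^{\perp}_{n,k}=A_{n,k}(Q_{1,1},\ldots,Q_{n-k+1,1})$. Then for all integers $n\ge k\ge0$: (i) $Q^{\perp}_{n,n-k}=(-1)^k\sum_{j=0}^k\binom{k+n}{k-j}\binom{k-n}{k+j}(Q^{\perp}_{1,1})^{n+j}Q_{k+j,j}$; (ii) $Q_{n,n-k}=(-1)^k\sum_{j=0}^k\binom{k+n}{k-j}\binom{k-n}{k+j}(Q_{1,1})^{n+j}Q^{\perp}_{k+j,j}$.
   Context: $\mathbb{K}$ is a field of characteristic zero; binomial coefficients $\binom mj$ with integer $m$ and $j\ge0$ are $m(m-1)\cdots(m-j+1)/j!$. Partial Bell polynomials: $B_{0,0}=1$, $B_{n,0}=0$ ($n\ge1$), $B_{n,k}=0$ ($k>n$), and for $1\le k\le n$, $B_{n,k}=\sum\frac{n!}{\prod_ir_i!(i!)^{r_i}}\prod_iX_i^{r_i}$ over non-negative integers with $\sum r_i=k$, $\sum ir_i=n$. $A_{n,k}\in\mathbb{K}[X_1^{-1},X_1,X_2,\ldots]$ is the unique lower triangular family with $A_{0,0}=1$, $A_{n,0}=0$ ($n\ge1$) and $\sum_{j=k}^nA_{n,j}B_{j,k}=\delta_{nk}$. A family $(Q_{n,k})_{n,k\ge0}$ is B-representable if $Q_{n,k}=0$ for $k>n$, $Q_{0,0}=1$, $Q_{n,0}=0$ ($n\ge1$), and there exist polynomials $H_j$ with $Q_{n,k}=B_{n,k}(H_1,\ldots,H_{n-k+1})$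 for all $1\le k\le n$; it is regular if its finite lower triangular matrices are nonsingular. The same conventions for index $0$ hold for $Q^{\perp}$. *)

theory Defs
  imports
    "HOL-Library.Poly_Mapping"
    "HOL-Computational_Algebra.Polynomial_Factorial"
    "Jordan_Normal_Form.Determinant"
begin

text \<open>
  Laurent polynomials over \<open>'k\<close> in indeterminates indexed by \<open>nat\<close>: a monomial is a finitely
  supported map from indices to integer exponents, and index \<open>i\<close> stands for the indeterminate
  \<open>X\<^sub>i\<close>. The ring \<open>K[X\<^sub>1\<inverse>, X\<^sub>1, X\<^sub>2, \<dots>]\<close> is the subring \<open>poly_ring\<close>, in which \<open>X\<^sub>0\<close> does not
  occur and only \<open>X\<^sub>1\<close> may have negative exponents.
\<close>

type_synonym 'k laurent = "(nat \<Rightarrow>\<^sub>0 int) \<Rightarrow>\<^sub>0 'k"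

definition poly_ring :: "'k::field_char_0 laurent set" where
  "poly_ring = {p. \<forall>m\<in>Poly_Mapping.keys p.
     Poly_Mapping.lookup m 0 = 0 \<and> (\<forall>i\<ge>2. Poly_Mapping.lookup m i \<ge> 0)}"

definition const_laurent :: "'k::field_char_0 \<Rightarrow> 'k laurent" where
  "const_laurent c = Poly_Mapping.single 0 c"

definition indet :: "nat \<Rightarrow> 'k::field_char_0 laurent" where
  "indet i = Poly_Mapping.single (Poly_Mapping.single i 1) 1"

definition const_fract :: "'k::field_char_0 \<Rightarrow> 'k laurent fract" where
  "const_fract c = to_fract (const_laurent c)"

text \<open>
  \<open>laurent_subst h p\<close> is \<open>p(h\<^sub>1, h\<^sub>2, \<dots>)\<close>. Values are taken in the fraction field, because a substitution
  into \<open>X\<^sub>1\<inverse>\<close> need not stay inside \<open>poly_ring\<close>. On \<open>poly_ring\<close> it is a ring homomorphism as soon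
  as \<open>h 1 \<noteq> 0\<close>.
\<close>

definition laurent_subst :: "(nat \<Rightarrow> 'k laurent fract) \<Rightarrow> 'k::field_char_0 laurent \<Rightarrow> 'k laurent fract" where
  "laurent_subst h p = (\<Sum>m\<in>Poly_Mapping.keys p.
     const_fract (Poly_Mapping.lookup p m) *
     (\<Prod>i\<in>Poly_Mapping.keys m. h i powi Poly_Mapping.lookup m i))"

text \<open>
  The exponents \<open>r\<^sub>i\<close> with \<open>i > n\<close> vanish automatically when \<open>\<Sum>i r\<^sub>i = n\<close>; the support condition
  makes this explicit.
\<close>

definition bell_exponents :: "nat \<Rightarrow> nat \<Rightarrow> (nat \<Rightarrow> nat) set" where
  "bell_exponents n k = {r. (\<forall>i. i \<notin> {1..n} \<longrightarrow> r i = 0) \<and>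
     (\<Sum>i=1..n. r i) = k \<and> (\<Sum>i=1..n. i * r i) = n}"

definition bell_B :: "nat \<Rightarrow> nat \<Rightarrow> 'k::field_char_0 laurent" where
  "bell_B n k =
    (if k = 0 then (if n = 0 then 1 else 0)
     else if k > n then 0
     else \<Sum>r\<in>bell_exponents n k.
       const_laurent (fact n / (\<Prod>i=1..n. fact (r i) * fact i ^ r i)) * (\<Prod>i=1..n. indet i ^ r i))"

definition stirling_A :: "nat \<Rightarrow> nat \<Rightarrow> 'k::field_char_0 laurent" where
  "stirling_A = (THE A.
     (\<forall>n k. A n k \<in> poly_ring) \<and>
     (\<forall>n k. n < k \<longrightarrow> A n k = 0) \<and>
     A 0 0 = 1 \<and> (\<forall>n\<ge>1. A n 0 = 0) \<and>
     (\<forall>n k. (\<Sum>j=k..n. A n j * bell_B j k) = (if n = k then 1 else 0)))"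

definition B_representable :: "(nat \<Rightarrow> nat \<Rightarrow> 'k::field_char_0 laurent) \<Rightarrow> bool" where
  "B_representable Q \<longleftrightarrow>
     (\<forall>n k. Q n k \<in> poly_ring) \<and>
     (\<forall>n k. n < k \<longrightarrow> Q n k = 0) \<and>
     Q 0 0 = 1 \<and> (\<forall>n\<ge>1. Q n 0 = 0) \<and>
     (\<exists>H. (\<forall>j. H j \<in> poly_ring) \<and>
       (\<forall>n k. 1 \<le> k \<and> k \<le> n \<longrightarrow>
          to_fract (Q n k) = laurent_subst (\<lambda>j. to_fract (H j)) (bell_B n k)))"

definition regular_family :: "(nat \<Rightarrow> nat \<Rightarrow> 'k::field_char_0 laurent) \<Rightarrow> bool" where
  "regular_family Q \<longleftrightarrow> (\<forall>n. det (mat n n (\<lambda>(i, j). Q i j)) \<noteq> 0)"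

definition companion :: "(nat \<Rightarrow> nat \<Rightarrow> 'k::field_char_0 laurent) \<Rightarrow> nat \<Rightarrow> nat \<Rightarrow> 'k laurent fract" where
  "companion Q n k = laurent_subst (\<lambda>j. to_fract (Q j 1)) (stirling_A n k)"

end

theory Submission
  imports Defs "HOL-Computational_Algebra.Formal_Power_Series"
begin

text \<open>
  Let \<open>f = \<Sum>j\<ge>1. Q\<^sub>j\<^sub>,\<^sub>1 x\<^sup>j / j!\<close> and let \<open>g\<close> be its compositional inverse. Then \<open>Q\<^sub>n\<^sub>,\<^sub>k\<close> is \<open>n!/k!\<close> times
  the coefficient of \<open>x\<^sup>n\<close> in \<open>f\<^sup>k\<close>, and the companion is the same expression in \<open>g\<close>, because both are left
  inverses of the same triangular matrix. Write \<open>f = x p\<close>. Lagrange inversion expresses the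
  coefficients of \<open>g\<^sup>n\<^sup>-\<^sup>k\<close> by those of \<open>p\<^sup>-\<^sup>n\<close>; expanding \<open>p\<^sup>-\<^sup>n\<close> by the binomial series in
  \<open>p / Q\<^sub>1\<^sub>,\<^sub>1 - 1\<close> turns it into a combination of the powers \<open>p\<^sup>j\<close> with \<open>j \<le> k\<close>, which is (i).
  Interchanging \<open>f\<close> and \<open>g\<close> gives (ii).
\<close>

section \<open>Lagrange inversion for power series\<close>

text \<open>Values of substitutions lie in a fraction field; with this instance the power series
  results over fields of characteristic zero apply to them.\<close>

instance fract :: ("{idom,ring_char_0}") field_char_0
proof
  have "of_nat n = to_fract (of_nat n :: 'a)" for n
    by (induction n) auto
  then show "inj (of_nat :: nat \<Rightarrow> 'a fract)"
    by (auto simp: inj_def)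
qed

text \<open>Back substitution from column \<open>n\<close> downwards: the equation for column
  \<open>k\<close> involves only entries of index at least \<open>k\<close>, and the nonzero
  diagonal entry can be cancelled.\<close>

lemma triangular_row_unique:
  fixes B :: "nat \<Rightarrow> nat \<Rightarrow> 'a::idom"
  assumes diag: "\<And>k. k \<le> n \<Longrightarrow> B k k \<noteq> 0"
    and eq: "\<And>k. k \<le> n \<Longrightarrow> (\<Sum>j=k..n. a j * B j k) = (\<Sum>j=k..n. b j * B j k)"
    and "k \<le> n"
  shows "a k = b k"
  using \<open>k \<le> n\<close>
proof (induction "n - k" arbitrary: k rule: less_induct)
  case less
  have "(\<Sum>j=Suc k..n. a j * B j k) = (\<Sum>j=Suc k..n. b j * B j k)"
    using less by (intro sum.cong) auto
  then have "a k * B k k = b k * B k k"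
    using eq[OF less.prems] less.prems by (simp add: sum.atLeast_Suc_atMost)
  then show ?case
    using diag[OF less.prems] by simp
qed

text \<open>For \<open>f\<close> with zero constant term this is the value of the partial Bell
  polynomial at the sequence \<open>j!\<close> times the \<open>j\<close>-th coefficient of
  \<open>f\<close>.\<close>

definition bell_coeff :: "'a::field_char_0 fps \<Rightarrow> nat \<Rightarrow> nat \<Rightarrow> 'a" where
  "bell_coeff f n k = fact n / fact k * fps_nth (f ^ k) n"

lemma fps_X_mult_power_nth:
  fixes p :: "'a::comm_ring_1 fps"
  shows "fps_nth ((fps_X * p) ^ k) n = (if n < k then 0 else fps_nth (p ^ k) (n - k))"
  by (simp add: power_mult_distrib fps_X_power_mult_nth)

lemma fps_X_deriv_nth: "fps_nth (fps_X * fps_deriv f) n = of_nat n * fps_nth f n"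
  by (cases n) auto

text \<open>Compares coefficients in \<open>f ^ k oo g = fps_X ^ k\<close>. As \<open>f ^ k\<close>
  has order at least \<open>k\<close>, the terms with \<open>j < k\<close> drop out.\<close>

lemma fps_power_compinv_orthogonal:
  fixes f g :: "'a::field fps"
  assumes f0: "fps_nth f 0 = 0" and g0: "fps_nth g 0 = 0" and inv: "f oo g = fps_X"
  shows "(\<Sum>j=k..n. fps_nth (g ^ j) n * fps_nth (f ^ k) j) = (if n = k then 1 else 0)"
proof -
  have low: "fps_nth (f ^ k) j = 0" if "j < k" for j
    using that f0 by (simp add: startsby_zero_power_prefix)
  have "fps_nth (fps_X ^ k) n = fps_nth (f ^ k oo g) n"
    by (simp add: fps_compose_power[OF g0, symmetric] inv)
  also have "\<dots> = (\<Sum>j=0..n. fps_nth (f ^ k) j * fps_nth (g ^ j) n)"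
    by (simp add: fps_compose_nth)
  also have "\<dots> = (\<Sum>j=k..n. fps_nth (f ^ k) j * fps_nth (g ^ j) n)"
    by (rule sum.mono_neutral_right) (auto simp: low)
  finally show ?thesis
    by (simp add: mult.commute)
qed

text \<open>For \<open>f = fps_X * p\<close> the sum is \<open>k\<close> times the formal residue of
  \<open>f^(k-n-1) f'\<close>, hence zero unless \<open>k = n\<close>. Using powers of
  \<open>q = 1/p\<close> keeps the computation among ordinary power series.\<close>

lemma fps_inverse_power_orthogonal:
  fixes p :: "'a::field_char_0 fps"
  assumes p0: "fps_nth p 0 \<noteq> 0" and "n \<ge> 1" and "k \<le> n"
  shows "(\<Sum>j=k..n. of_nat j * fps_nth (inverse p ^ n) (n - j) * fps_nth ((fps_X * p) ^ k) j)
       = (if n = k then of_nat n else 0)"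
proof -
  define q where "q = inverse p"
  have qp: "q * p = 1"
    unfolding q_def by (rule inverse_mult_eq_1[OF p0])
  have dq: "fps_deriv q = - fps_deriv p * q\<^sup>2"
    unfolding q_def by (rule fps_inverse_deriv[OF p0])
  let ?S = "\<Sum>j=k..n. of_nat j * fps_nth (q ^ n) (n - j) * fps_nth ((fps_X * p) ^ k) j"
  have "?S = (\<Sum>j=0..n. fps_nth (fps_X * fps_deriv ((fps_X * p) ^ k)) j * fps_nth (q ^ n) (n - j))"
    unfolding fps_X_deriv_nth
    by (rule sum.mono_neutral_cong_left) (auto simp: fps_X_mult_power_nth)
  also have "\<dots> = fps_nth (fps_X * fps_deriv ((fps_X * p) ^ k) * q ^ n) n"
    by (simp add: fps_mult_nth)
  finally have S: "?S = fps_nth (fps_X * fps_deriv ((fps_X * p) ^ k) * q ^ n) n" .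
  show ?thesis
  proof (cases "k = 0")
    case True
    with S \<open>n \<ge> 1\<close> show ?thesis by (simp add: q_def)
  next
    case False
    define r where "r = n - k"
    have qk: "p ^ i * q ^ (i + l) = q ^ l" for i l
    proof -
      have "p ^ i * q ^ (i + l) = (q * p) ^ i * q ^ l"
        by (simp add: power_add power_mult_distrib mult_ac)
      then show ?thesis by (simp add: qp)
    qed
    obtain i where k: "k = Suc i" using False by (cases k) auto
    have n: "n = k + r" using \<open>k \<le> n\<close> by (simp add: r_def)
    \<comment> \<open>The product rule leaves a factor \<open>fps_X ^ k\<close>; the powers of
      \<open>p\<close> then cancel against \<open>q ^ n\<close>, where \<open>n = k + r\<close>, and
      only the coefficient at \<open>r\<close> remains to be found.\<close>
    have "fps_X * fps_deriv ((fps_X * p) ^ k) * q ^ n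
        = of_nat k * fps_X ^ k * (p ^ k * q ^ n + fps_X * fps_deriv p * (p ^ i * q ^ n))"
      unfolding fps_deriv_power' k by (simp add: power_mult_distrib algebra_simps fps_of_nat)
    also have "p ^ k * q ^ n = q ^ r"
      unfolding n by (rule qk)
    also have "p ^ i * q ^ n = q ^ Suc r"
      using qk[of i "Suc r"] unfolding n k by simp
    finally have "?S = fps_nth (of_nat k * fps_X ^ k * (q ^ r + fps_X * fps_deriv p * q ^ Suc r)) n"
      using S by simp
    also have "\<dots> = of_nat k * fps_nth (q ^ r + fps_X * fps_deriv p * q ^ Suc r) r"
      unfolding mult.assoc fps_of_nat[symmetric] by (simp add: fps_X_power_mult_nth n)
    finally have S2: "?S = of_nat k * fps_nth (q ^ r + fps_X * fps_deriv p * q ^ Suc r) r" .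
    show ?thesis
    proof (cases "r = 0")
      case True
      with S2 n show ?thesis by (simp add: q_def)
    next
      case r: False
      \<comment> \<open>the coefficient of \<open>x\<^sup>r\<close> in \<open>x (q\<^sup>r)'\<close> is \<open>r\<close> times that in \<open>q\<^sup>r\<close>, so the difference vanishes\<close>
      have "of_nat r * (q ^ r + fps_X * fps_deriv p * q ^ Suc r)
         = of_nat r * q ^ r - fps_X * fps_deriv (q ^ r)"
        using r unfolding fps_deriv_power' dq
        by (cases r) (simp_all add: algebra_simps power2_eq_square fps_of_nat)
      then have "fps_nth (of_nat r * (q ^ r + fps_X * fps_deriv p * q ^ Suc r)) r = 0"
        unfolding fps_of_nat[symmetric] by (simp add: fps_X_deriv_nth)
      then have "fps_nth (q ^ r + fps_X * fps_deriv p * q ^ Suc r) r = 0"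
        using r unfolding fps_of_nat[symmetric] by simp
      with S2 r n show ?thesis by (simp add: q_def)
    qed
  qed
qed

text \<open>As functions of \<open>m\<close>, both sides solve the same triangular system, whose
  matrix consists of the coefficients of the powers of \<open>fps_X * p\<close>; the two
  orthogonality lemmas supply the right-hand sides.\<close>

lemma fps_lagrange_inversion:
  fixes p g :: "'a::field_char_0 fps"
  assumes p0: "fps_nth p 0 \<noteq> 0" and g0: "fps_nth g 0 = 0" and inv: "(fps_X * p) oo g = fps_X"
    and "n \<ge> 1" and "m \<le> n"
  shows "of_nat n * fps_nth (g ^ m) n = of_nat m * fps_nth (inverse p ^ n) (n - m)"
proof (rule triangular_row_unique[where k = m
      and a = "\<lambda>j. of_nat n * fps_nth (g ^ j) n"
      and b = "\<lambda>j. of_nat j * fps_nth (inverse p ^ n) (n - j)"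
      and B = "\<lambda>j k. fps_nth ((fps_X * p) ^ k) j" and n = n])
  show "fps_nth ((fps_X * p) ^ k) k \<noteq> 0" if "k \<le> n" for k
    using p0 by (simp add: fps_X_mult_power_nth fps_nth_power_0)
  fix k assume "k \<le> n"
  have "(\<Sum>j=k..n. fps_nth (g ^ j) n * fps_nth ((fps_X * p) ^ k) j) = (if n = k then 1 else 0)"
    by (rule fps_power_compinv_orthogonal) (use g0 inv in auto)
  then show "(\<Sum>j=k..n. of_nat n * fps_nth (g ^ j) n * fps_nth ((fps_X * p) ^ k) j)
      = (\<Sum>j=k..n. of_nat j * fps_nth (inverse p ^ n) (n - j) * fps_nth ((fps_X * p) ^ k) j)"
    unfolding fps_inverse_power_orthogonal[OF p0 \<open>n \<ge> 1\<close> \<open>k \<le> n\<close>]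
    by (simp add: mult.assoc sum_distrib_left[symmetric] del: of_nat_Suc)
qed (use \<open>m \<le> n\<close> in auto)

section \<open>Expansion of negative powers in terms of positive powers\<close>

text \<open>Trinomial revision extracts \<open>a gchoose j\<close>; what remains is an alternating
  partial row sum of binomials, which has a closed form, and negating the upper index gives
  \<open>of_nat k - a\<close>.\<close>

lemma gbinomial_alternating_sum:
  fixes a :: "'a::field_char_0"
  assumes "j \<le> k"
  shows "(\<Sum>i=j..k. (a gchoose i) * (of_nat (i choose j) * (-1) ^ (i - j)))
       = (a gchoose j) * (of_nat k - a gchoose (k - j))"
proof -
  have "(\<Sum>i=j..k. (a gchoose i) * (of_nat (i choose j) * (-1) ^ (i - j)))
      = (\<Sum>i=j..k. (a gchoose j) * ((a - of_nat j gchoose (i - j)) * (-1) ^ (i - j)))"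
    by (rule sum.cong) (auto simp: gbinomial_trinomial_revision mult.assoc[symmetric] binomial_gbinomial)
  also have "\<dots> = (a gchoose j) * (\<Sum>i\<le>k - j. (a - of_nat j gchoose i) * (-1) ^ i)"
    unfolding sum_distrib_left
    by (rule sum.reindex_bij_witness[of _ "\<lambda>i. i + j" "\<lambda>i. i - j"]) (use assms in auto)
  also have "(\<Sum>i\<le>k - j. (a - of_nat j gchoose i) * (-1) ^ i) = (of_nat k - a gchoose (k - j))"
    unfolding gbinomial_sum_lower_neg
    by (subst (2) gbinomial_negated_upper) (use assms in \<open>simp add: of_nat_diff algebra_simps\<close>)
  finally show ?thesis .
qed

lemma fps_inverse_power_nth:
  fixes p :: "'a::field_char_0 fps"
  assumes a: "fps_nth p 0 = a" "a \<noteq> 0"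
  shows "fps_nth (inverse p ^ n) k = (\<Sum>j=0..k. (- of_nat n gchoose j) *
      (of_nat k + of_nat n gchoose (k - j)) * inverse a ^ (n + j) * fps_nth (p ^ j) k)"
proof -
  \<comment> \<open>Normalised to have zero constant term, so that the binomial series in
    \<open>u\<close> makes sense and only its terms up to \<open>u ^ k\<close> reach the coefficient
    at \<open>k\<close>.\<close>
  define u where "u = fps_const (inverse a) * p - 1"
  have u0: "fps_nth u 0 = 0" using a by (simp add: u_def)
  have p: "p = fps_const a * (1 + u)" using a by (simp add: u_def algebra_simps flip: mult.assoc)
  have "inverse p = fps_const (inverse a) * inverse (1 + u)"
    by (simp add: p fps_inverse_mult fps_const_inverse)
  then have "inverse p ^ n = fps_const (inverse a ^ n) * inverse ((1 + u) ^ n)"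
    by (simp add: power_mult_distrib fps_const_power fps_inverse_power)
  also have "inverse ((1 + u) ^ n) = fps_binomial (- of_nat n) oo u"
    by (simp add: fps_binomial_minus_of_nat fps_inverse_compose[OF u0] fps_compose_power[OF u0, symmetric]
        fps_compose_add_distrib fps_nth_power_0 u0)
  finally have "fps_nth (inverse p ^ n) k
      = inverse a ^ n * (\<Sum>i=0..k. (- of_nat n gchoose i) * fps_nth (u ^ i) k)"
    by (simp add: fps_compose_nth)
  also have "(\<Sum>i=0..k. (- of_nat n gchoose i) * fps_nth (u ^ i) k)
     = (\<Sum>i=0..k. \<Sum>j=0..i. (- of_nat n gchoose i) * (of_nat (i choose j) * (-1) ^ (i - j)) *
          (inverse a ^ j * fps_nth (p ^ j) k))"
  proof (rule sum.cong[OF refl])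
    fix i
    have "u ^ i = (\<Sum>j\<le>i. of_nat (i choose j) * (fps_const (inverse a) * p) ^ j * (-1) ^ (i - j))"
      unfolding u_def diff_conv_add_uminus by (rule binomial_ring)
    also have "\<dots> = (\<Sum>j=0..i. fps_const (of_nat (i choose j) * (-1) ^ (i - j) * inverse a ^ j) * p ^ j)"
    proof (rule sum.cong)
      fix j
      have "fps_const ((-1) ^ (i - j)) = (-1 :: 'a fps) ^ (i - j)"
        unfolding fps_const_power[symmetric] fps_const_neg[symmetric] by simp
      then show "of_nat (i choose j) * (fps_const (inverse a) * p) ^ j * (-1) ^ (i - j)
          = fps_const (of_nat (i choose j) * (-1) ^ (i - j) * inverse a ^ j) * p ^ j"
        unfolding fps_const_mult[symmetric] fps_of_nat
        by (simp add: power_mult_distrib fps_const_power mult_ac)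
    qed auto
    finally show "(- of_nat n gchoose i) * fps_nth (u ^ i) k = 
       (\<Sum>j=0..i. (- of_nat n gchoose i) * (of_nat (i choose j) * (-1) ^ (i - j)) *
          (inverse a ^ j * fps_nth (p ^ j) k))"
      by (simp add: fps_sum_nth sum_distrib_left mult_ac)
  qed
  \<comment> \<open>Exchanging the sums over the triangle \<open>j \<le> i \<le> k\<close> makes the
    inner sum the alternating one, with upper index \<open>- of_nat n\<close>.\<close>
  also have "\<dots> = (\<Sum>j=0..k. \<Sum>i=j..k. (- of_nat n gchoose i) * (of_nat (i choose j) * (-1) ^ (i - j)) *
          (inverse a ^ j * fps_nth (p ^ j) k))"
    unfolding sum.Sigma[OF finite_atLeastAtMost ballI[OF finite_atLeastAtMost]]
    by (rule sum.reindex_bij_witness[of _ prod.swap prod.swap]) auto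
  also have "\<dots> = (\<Sum>j=0..k. (- of_nat n gchoose j) * (of_nat k + of_nat n gchoose (k - j)) *
          (inverse a ^ j * fps_nth (p ^ j) k))"
    by (rule sum.cong) (simp_all add: gbinomial_alternating_sum flip: sum_distrib_right)
  finally show ?thesis
    by (simp add: sum_distrib_left power_add mult_ac)
qed

text \<open>The rising factorial of \<open>n - k\<close> of length \<open>k + j\<close> splits into
  those of \<open>n - k\<close> of length \<open>k\<close> and of \<open>n\<close> of length
  \<open>j\<close>. This merges the Lagrange factor and the factorials from
  \<open>bell_coeff\<close> into one binomial.\<close>

lemma gbinomial_pochhammer_shift:
  fixes n k j :: nat
  assumes "k < n"
  shows "fact n / fact (n - k) * (of_nat (n - k) / of_nat n) * (- of_nat n gchoose j) * (fact j / fact (k + j))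
     = ((-1) ^ k * (of_nat k - of_nat n gchoose (k + j)) :: 'a::field_char_0)"
proof -
  obtain m where n: "n = Suc m + k" using less_imp_Suc_add[OF assms] by (auto simp: add_ac)
  have "pochhammer (of_nat (Suc m)) k * fact m = (fact (m + k) :: 'a)"
  proof (induction k)
    case (Suc k)
    have "pochhammer (of_nat (Suc m)) (Suc k) * fact m
        = (pochhammer (of_nat (Suc m)) k * fact m) * (of_nat (Suc (m + k)) :: 'a)"
      by (simp add: pochhammer_Suc mult_ac add_ac)
    with Suc show ?case by (simp add: mult_ac)
  qed simp
  then have "pochhammer (of_nat (Suc m)) k = (fact (m + k) / fact m :: 'a)"
    by (simp add: field_simps)
  moreover have "(fact n / fact (n - k) * (of_nat (n - k) / of_nat n) :: 'a) = fact (m + k) / fact m"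
    unfolding n by (simp add: field_simps del: of_nat_Suc of_nat_add)
  moreover have "pochhammer (of_nat (n - k)) (k + j) = (pochhammer (of_nat (n - k)) k * pochhammer (of_nat n) j :: 'a)"
    using assms by (simp add: pochhammer_product' of_nat_diff)
  moreover have "n - k = Suc m" unfolding n by simp
  ultimately have "pochhammer (of_nat (n - k)) (k + j)
      = fact n / fact (n - k) * (of_nat (n - k) / of_nat n) * (pochhammer (of_nat n) j :: 'a)"
    by simp
  moreover have "- (of_nat k - of_nat n) = (of_nat (n - k) :: 'a)"
    using assms by (simp add: of_nat_diff)
  ultimately show ?thesis
    unfolding gbinomial_pochhammer by (simp add: power_add)
qed

text \<open>Both claims of the theorem are instances of this identity. Lagrange inversion with
  exponent \<open>n - k\<close> asks for the coefficient of \<open>inverse p ^ n\<close> at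
  \<open>k\<close>, and that of \<open>p ^ j\<close> at \<open>k\<close> is that of
  \<open>f ^ j\<close> at \<open>k + j\<close>.\<close>

lemma bell_coeff_compinv:
  fixes f g :: "'a::field_char_0 fps"
  assumes f0: "fps_nth f 0 = 0" and g0: "fps_nth g 0 = 0" and f1: "fps_nth f 1 = a" "a \<noteq> 0"
    and inv: "f oo g = fps_X" and "k \<le> n"
  shows "bell_coeff g n (n - k) = (-1) ^ k * (\<Sum>j=0..k. (of_nat k + of_nat n gchoose (k - j)) *
     (of_nat k - of_nat n gchoose (k + j)) * inverse a ^ (n + j) * bell_coeff f (k + j) j)"
\<comment> \<open>The binomial shift requires \<open>k < n\<close>. For \<open>k = n > 0\<close>
  both sides vanish: on the right, \<open>0 gchoose (k + j)\<close> with
  \<open>k + j > 0\<close>.\<close>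
proof (cases "k = n")
  case True
  show ?thesis
  proof (cases "n = 0")
    case False
    with True have "(\<Sum>j=0..k. (of_nat k + of_nat n gchoose (k - j)) *
     (of_nat k - of_nat n gchoose (k + j)) * inverse a ^ (n + j) * bell_coeff f (k + j) j) = 0"
      by (intro sum.neutral) (auto simp: gbinomial_0_left)
    with True False show ?thesis by (simp add: bell_coeff_def)
  qed (use True in \<open>simp add: bell_coeff_def\<close>)
next
  case False
  with \<open>k \<le> n\<close> have kn: "k < n" by simp
  define p where "p = fps_shift 1 f"
  have f: "f = fps_X * p"
    unfolding p_def using f0 by (intro fps_ext) auto
  have p0: "fps_nth p 0 = a" using f1 by (simp add: p_def)
  have "of_nat n * fps_nth (g ^ (n - k)) n = of_nat (n - k) * fps_nth (inverse p ^ n) (n - (n - k))"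
    by (rule fps_lagrange_inversion) (use p0 f1 g0 inv f kn in auto)
  then have "fps_nth (g ^ (n - k)) n = of_nat (n - k) / of_nat n * fps_nth (inverse p ^ n) k"
    using kn by (simp add: field_simps)
  then have "bell_coeff g n (n - k)
      = fact n / fact (n - k) * (of_nat (n - k) / of_nat n) * fps_nth (inverse p ^ n) k"
    by (simp add: bell_coeff_def)
  also have "\<dots> = (\<Sum>j=0..k. (fact n / fact (n - k) * (of_nat (n - k) / of_nat n) * (- of_nat n gchoose j) * (fact j / fact (k + j))) *
      ((of_nat k + of_nat n gchoose (k - j)) * inverse a ^ (n + j) * bell_coeff f (k + j) j))"
    unfolding fps_inverse_power_nth[OF p0 f1(2)] sum_distrib_left
    by (rule sum.cong) (simp_all add: bell_coeff_def f fps_X_mult_power_nth)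
  finally show ?thesis
    unfolding gbinomial_pochhammer_shift[OF kn] by (simp add: sum_distrib_left mult_ac)
qed

section \<open>Substitution into Laurent polynomials\<close>

lemma const_fract_0 [simp]: "const_fract 0 = 0"
  by (simp add: const_fract_def const_laurent_def)

lemma const_fract_1 [simp]: "const_fract 1 = 1"
  by (simp add: const_fract_def const_laurent_def)

lemma const_fract_add: "const_fract (a + b) = const_fract a + const_fract b"
  by (simp add: const_fract_def const_laurent_def single_add)

lemma const_fract_diff: "const_fract (a - b) = const_fract a - const_fract b"
  by (simp add: const_fract_def const_laurent_def single_diff)

lemma const_fract_mult: "const_fract (a * b) = const_fract a * const_fract b"
  by (simp add: const_fract_def const_laurent_def mult_single flip: to_fract_mult)

lemma const_fract_of_nat [simp]: "const_fract (of_nat n) = of_nat n"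
  by (induction n) (simp_all add: const_fract_add)

lemma const_fract_of_int [simp]: "const_fract (of_int n) = of_int n"
  by (cases n rule: int_cases2) (simp_all add: const_fract_diff[of 0, simplified])

lemma const_fract_prod: "const_fract (prod f A) = (\<Prod>x\<in>A. const_fract (f x))"
  by (induction A rule: infinite_finite_induct) (simp_all add: const_fract_mult)

lemma const_fract_power: "const_fract (a ^ n) = const_fract a ^ n"
  by (induction n) (simp_all add: const_fract_mult)

lemma const_fract_divide: "const_fract (a / b) = const_fract a / const_fract b"
proof (cases "b = 0")
  case False
  then have "const_fract (a / b) * const_fract b = const_fract a"
    by (simp flip: const_fract_mult)
  moreover have "const_fract b * const_fract (inverse b) = 1"
    using False by (simp flip: const_fract_mult)
  then have "const_fract b \<noteq> 0"
    by auto
  ultimately show ?thesis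
    by (simp add: field_simps)
qed simp

lemma const_fract_fact [simp]: "const_fract (fact n) = fact n"
  using const_fract_of_nat[of "fact n"] by simp

lemma const_fract_gchoose: "const_fract (a gchoose k) = (const_fract a gchoose k)"
  by (simp add: gbinomial_prod_rev const_fract_divide const_fract_prod const_fract_diff)

text \<open>Terms may cancel in a sum, so additivity is checked over a common superset of the
  supports.\<close>

lemma laurent_subst_superset:
  assumes "finite S" "Poly_Mapping.keys p \<subseteq> S"
  shows "laurent_subst h p = (\<Sum>m\<in>S. const_fract (Poly_Mapping.lookup p m) *
     (\<Prod>i\<in>Poly_Mapping.keys m. h i powi Poly_Mapping.lookup m i))"
  unfolding laurent_subst_def
  by (rule sum.mono_neutral_left) (use assms in \<open>auto simp: not_in_keys_iff_lookup_eq_zero\<close>)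

lemma laurent_subst_single:
  assumes "finite S" "Poly_Mapping.keys m \<subseteq> S"
  shows "laurent_subst h (Poly_Mapping.single m c) =
    const_fract c * (\<Prod>i\<in>S. h i powi Poly_Mapping.lookup m i)"
proof -
  have "laurent_subst h (Poly_Mapping.single m c) =
    const_fract c * (\<Prod>i\<in>Poly_Mapping.keys m. h i powi Poly_Mapping.lookup m i)"
    by (subst laurent_subst_superset[of "{m}"]) auto
  also have "(\<Prod>i\<in>Poly_Mapping.keys m. h i powi Poly_Mapping.lookup m i)
      = (\<Prod>i\<in>S. h i powi Poly_Mapping.lookup m i)"
    by (rule prod.mono_neutral_left) (use assms in \<open>auto simp: not_in_keys_iff_lookup_eq_zero\<close>)
  finally show ?thesis .
qed

lemma laurent_subst_add: "laurent_subst h (p + q) = laurent_subst h p + laurent_subst h q"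
proof -
  let ?S = "Poly_Mapping.keys p \<union> Poly_Mapping.keys q"
  have "Poly_Mapping.keys (p + q) \<subseteq> ?S"
    by (rule keys_add)
  then show ?thesis
    by (subst (1 2 3) laurent_subst_superset[of ?S])
      (auto simp: lookup_add const_fract_add algebra_simps sum.distrib)
qed

lemma laurent_subst_0 [simp]: "laurent_subst h 0 = 0"
  by (simp add: laurent_subst_def)

lemma laurent_subst_1 [simp]: "laurent_subst h 1 = 1"
  by (simp add: laurent_subst_def)

lemma laurent_subst_sum: "laurent_subst h (sum f A) = (\<Sum>x\<in>A. laurent_subst h (f x))"
  by (induction A rule: infinite_finite_induct) (simp_all add: laurent_subst_add)

lemma poly_mapping_eq_sum_single:
  fixes p :: "'a \<Rightarrow>\<^sub>0 'b::comm_monoid_add"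
  shows "p = (\<Sum>m\<in>Poly_Mapping.keys p. Poly_Mapping.single m (Poly_Mapping.lookup p m))"
proof (rule poly_mapping_eqI)
  fix k
  show "Poly_Mapping.lookup p k =
    Poly_Mapping.lookup (\<Sum>m\<in>Poly_Mapping.keys p. Poly_Mapping.single m (Poly_Mapping.lookup p m)) k"
    by (simp add: lookup_sum lookup_single when_def not_in_keys_iff_lookup_eq_zero)
qed

lemma poly_ringD:
  assumes "p \<in> poly_ring" "m \<in> Poly_Mapping.keys p"
  shows "Poly_Mapping.lookup m 0 = 0" "i \<noteq> 1 \<Longrightarrow> Poly_Mapping.lookup m i \<ge> 0"
  using assms by (cases "i = 0"; auto simp: poly_ring_def)+

lemma laurent_subst_mult:
  assumes p: "p \<in> poly_ring" and q: "q \<in> poly_ring" and h1: "h 1 \<noteq> 0"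
  shows "laurent_subst h (p * q) = laurent_subst h p * laurent_subst h q"
proof -
  let ?P = "\<lambda>m. Poly_Mapping.single m (Poly_Mapping.lookup p m)"
  let ?Q = "\<lambda>m. Poly_Mapping.single m (Poly_Mapping.lookup q m)"
  have single: "laurent_subst h (?P m * ?Q m') = laurent_subst h (?P m) * laurent_subst h (?Q m')"
    if m: "m \<in> Poly_Mapping.keys p" "m' \<in> Poly_Mapping.keys q" for m m'
  proof -
    let ?S = "Poly_Mapping.keys m \<union> Poly_Mapping.keys m'"
    \<comment> \<open>The exponent law can fail for base zero with negative exponents. These occur
      in \<open>poly_ring\<close> only at index 1, where \<open>h 1\<close> is nonzero.\<close>
    have "h i powi (Poly_Mapping.lookup m i + Poly_Mapping.lookup m' i)
        = h i powi Poly_Mapping.lookup m i * h i powi Poly_Mapping.lookup m' i" for i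
    proof (cases "i = 1")
      case True
      with h1 show ?thesis by (simp add: power_int_add)
    next
      case False
      with p q m have "Poly_Mapping.lookup m i \<ge> 0" "Poly_Mapping.lookup m' i \<ge> 0"
        by (auto intro: poly_ringD)
      then show ?thesis
        by (auto simp: nonneg_int_cases power_int_def nat_add_distrib power_add)
    qed
    moreover have "Poly_Mapping.keys (m + m') \<subseteq> ?S"
      by (rule keys_add)
    ultimately show ?thesis
      unfolding mult_single
      by (subst (1 2 3) laurent_subst_single[of ?S])
        (auto simp: const_fract_mult lookup_add prod.distrib)
  qed
  have "p * q = (\<Sum>m\<in>Poly_Mapping.keys p. ?P m) * (\<Sum>m'\<in>Poly_Mapping.keys q. ?Q m')"
    by (simp flip: poly_mapping_eq_sum_single)
  then have "laurent_subst h (p * q) = (\<Sum>m\<in>Poly_Mapping.keys p. \<Sum>m'\<in>Poly_Mapping.keys q.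
      laurent_subst h (?P m) * laurent_subst h (?Q m'))"
    by (simp add: sum_product laurent_subst_sum single)
  also have "\<dots> = laurent_subst h (\<Sum>m\<in>Poly_Mapping.keys p. ?P m) *
      laurent_subst h (\<Sum>m'\<in>Poly_Mapping.keys q. ?Q m')"
    by (simp add: laurent_subst_sum sum_product)
  finally show ?thesis
    by (simp flip: poly_mapping_eq_sum_single)
qed

section \<open>Closure properties of \<open>poly_ring\<close>\<close>

lemma poly_ring_0 [simp]: "0 \<in> poly_ring"
  by (simp add: poly_ring_def)

lemma poly_ring_add: "p \<in> poly_ring \<Longrightarrow> q \<in> poly_ring \<Longrightarrow> p + q \<in> poly_ring"
  using keys_add[of p q] by (force simp: poly_ring_def)

lemma poly_ring_sum: "(\<And>x. x \<in> A \<Longrightarrow> f x \<in> poly_ring) \<Longrightarrow> sum f A \<in> poly_ring"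
  by (induction A rule: infinite_finite_induct) (auto simp: poly_ring_add)

lemma poly_ring_mult:
  assumes "p \<in> poly_ring" "q \<in> poly_ring"
  shows "p * q \<in> poly_ring"
  unfolding poly_ring_def mem_Collect_eq
proof
  fix m assume "m \<in> Poly_Mapping.keys (p * q)"
  then obtain a b where m: "m = a + b" and a: "a \<in> Poly_Mapping.keys p" and b: "b \<in> Poly_Mapping.keys q"
    using keys_mult[of p q] by blast
  then show "Poly_Mapping.lookup m 0 = 0 \<and> (\<forall>i\<ge>2. Poly_Mapping.lookup m i \<ge> 0)"
    using poly_ringD[OF assms(1) a] poly_ringD[OF assms(2) b] by (simp add: lookup_add)
qed

lemma poly_ring_diff: "p \<in> poly_ring \<Longrightarrow> q \<in> poly_ring \<Longrightarrow> p - q \<in> poly_ring"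
  using keys_diff[of p q] by (force simp: poly_ring_def)

lemma poly_ring_single:
  "Poly_Mapping.lookup m 0 = 0 \<Longrightarrow> (\<And>i. i \<ge> 2 \<Longrightarrow> Poly_Mapping.lookup m i \<ge> 0) \<Longrightarrow>
    Poly_Mapping.single m c \<in> poly_ring"
  by (auto simp: poly_ring_def)

section \<open>The inverse of the Bell matrix\<close>

text \<open>The exponent vector of a monomial in a Bell polynomial, with exponents as integers, so
  that each summand becomes a single Laurent term.\<close>

definition bell_monom :: "nat \<Rightarrow> (nat \<Rightarrow> nat) \<Rightarrow> (nat \<Rightarrow>\<^sub>0 int)" where
  "bell_monom n r = (\<Sum>i=1..n. Poly_Mapping.single i (int (r i)))"

lemma lookup_bell_monom:
  "Poly_Mapping.lookup (bell_monom n r) i = (if i \<in> {1..n} then int (r i) else 0)"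
  by (simp add: bell_monom_def lookup_sum lookup_single when_def)

lemma keys_bell_monom: "Poly_Mapping.keys (bell_monom n r) \<subseteq> {1..n}"
  by (auto simp: in_keys_iff lookup_bell_monom split: if_splits)

lemma indet_power: "indet i ^ e = Poly_Mapping.single (Poly_Mapping.single i (int e)) 1"
  by (induction e) (simp_all add: indet_def mult_single flip: single_add)

lemma prod_single:
  "(\<Prod>x\<in>A. Poly_Mapping.single (m x) (1 :: 'a::comm_semiring_1)) = Poly_Mapping.single (\<Sum>x\<in>A. m x) 1"
  by (induction A rule: infinite_finite_induct) (simp_all add: mult_single)

lemma bell_term_eq_single:
  "const_laurent c * (\<Prod>i=1..n. indet i ^ r i) = Poly_Mapping.single (bell_monom n r) c"
  by (simp add: indet_power prod_single const_laurent_def mult_single bell_monom_def)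

lemma bell_B_in_poly_ring: "bell_B n k \<in> (poly_ring :: 'k::field_char_0 laurent set)"
proof -
  have "(1 :: 'k laurent) \<in> poly_ring"
    using poly_ring_single[of 0 1] by simp
  then show ?thesis
    unfolding bell_B_def bell_term_eq_single
    by (auto intro!: poly_ring_sum poly_ring_single simp: lookup_bell_monom)
qed

text \<open>Subtracting the two constraints gives \<open>(i - 1) * r i\<close> summing to zero, so
  only \<open>r 1\<close> can be nonzero.\<close>

lemma bell_exponents_diag: "bell_exponents n n = {\<lambda>i. if i = 1 then n else 0}"
proof (intro subset_antisym subsetI)
  fix r assume "r \<in> bell_exponents n n"
  then have z: "\<And>i. i \<notin> {1..n} \<Longrightarrow> r i = 0" and s: "(\<Sum>i=1..n. r i) = n" and t: "(\<Sum>i=1..n. i * r i) = n"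
    by (auto simp: bell_exponents_def)
  have "(\<Sum>i=1..n. i * r i) = (\<Sum>i=1..n. (i - 1) * r i + r i)"
    by (rule sum.cong) (auto simp: algebra_simps)
  then have "(\<Sum>i=1..n. (i - 1) * r i) = 0"
    using s t by (simp add: sum.distrib)
  then have m: "(i - 1) * r i = 0" if "i \<in> {1..n}" for i
    using that by (subst (asm) sum_eq_0_iff) auto
  have r0: "r i = 0" if "i \<noteq> 1" for i
    using that z[of i] m[of i] by (cases "i \<in> {1..n}") auto
  have "(\<Sum>i=1..n. r i) = r 1"
  proof (cases "n = 0")
    case False
    have "(\<Sum>i=1..n. r i) = (\<Sum>i\<in>{1}. r i)"
      by (rule sum.mono_neutral_right) (use False r0 in auto)
    then show ?thesis by simp
  qed (use z in auto)
  then have "r 1 = n"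
    by (metis s)
  with r0 have "r i = (if i = 1 then n else 0)" for i
    by metis
  then show "r \<in> {\<lambda>i. if i = 1 then n else 0}"
    unfolding singleton_iff by (rule ext)
next
  fix r :: "nat \<Rightarrow> nat" assume "r \<in> {\<lambda>i. if i = 1 then n else 0}"
  then have r: "r i = (if i = 1 then n else 0)" for i
    by simp
  have sum: "(\<Sum>i=1..n. c i * r i) = c 1 * n" for c :: "nat \<Rightarrow> nat"
  proof (cases "n = 0")
    case False
    have "(\<Sum>i=1..n. c i * r i) = (\<Sum>i\<in>{1}. c i * r i)"
      by (rule sum.mono_neutral_right) (use False r in auto)
    then show ?thesis by (simp add: r)
  qed simp
  then show "r \<in> bell_exponents n n"
    using sum[of "\<lambda>_. 1"] sum[of "\<lambda>i. i"] r by (auto simp: bell_exponents_def)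
qed

lemma bell_B_diag: "bell_B n n = (indet 1 ^ n :: 'k::field_char_0 laurent)"
proof (cases "n = 0")
  case False
  have "(\<Prod>i=1..n. fact (if i = 1 then n else 0) * fact i ^ (if i = 1 then n else 0)) = (fact n :: 'k)"
    using False by (subst prod.mono_neutral_right[of _ "{1}"]) auto
  moreover have "bell_monom n (\<lambda>i. if i = 1 then n else 0) = Poly_Mapping.single 1 (int n)"
    using False by (intro poly_mapping_eqI) (auto simp: lookup_bell_monom lookup_single when_def)
  ultimately show ?thesis
    using False unfolding bell_B_def bell_term_eq_single bell_exponents_diag
    by (simp add: indet_power)
qed (simp add: bell_B_def)

text \<open>Here the inverse of the first indeterminate enters: the diagonal of the Bell matrix
  consists of units of \<open>poly_ring\<close>.\<close>

lemma bell_B_diag_unit: "bell_B n n * Poly_Mapping.single (Poly_Mapping.single 1 (- int n)) 1 = 1"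
  by (simp add: bell_B_diag indet_power mult_single flip: single_add)

lemma poly_ring_triangular_row_exists:
  fixes e :: "nat \<Rightarrow> 'k::field_char_0 laurent"
  assumes e: "\<And>k. e k \<in> poly_ring"
  shows "\<exists>a. (\<forall>k. a k \<in> poly_ring) \<and> (\<forall>k>n. a k = 0) \<and>
    (\<forall>k\<le>n. (\<Sum>j=k..n. a j * bell_B j k) = e k)"
proof -
  have "\<exists>a. (\<forall>k. a k \<in> poly_ring) \<and> (\<forall>k>n. a k = 0) \<and>
    (\<forall>k. 0 \<le> k \<and> k \<le> n \<longrightarrow> (\<Sum>j=k..n. a j * bell_B j k) = e k)"
  \<comment> \<open>Downward induction on the first column treated, starting at
    \<open>Suc n\<close>, where no equation has to hold.\<close>
  proof (rule inc_induct[of 0 "Suc n"])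
    fix l assume l: "l < Suc n" and "\<exists>a. (\<forall>k. a k \<in> poly_ring) \<and> (\<forall>k>n. a k = 0) \<and>
      (\<forall>k. Suc l \<le> k \<and> k \<le> n \<longrightarrow> (\<Sum>j=k..n. a j * bell_B j k) = e k)"
    then obtain a where a: "\<And>k. a k \<in> poly_ring" "\<And>k. k > n \<Longrightarrow> a k = 0"
      "\<And>k. Suc l \<le> k \<Longrightarrow> k \<le> n \<Longrightarrow> (\<Sum>j=k..n. a j * bell_B j k) = e k"
      by blast
    define U :: "'k laurent" where "U = Poly_Mapping.single (Poly_Mapping.single 1 (- int l)) 1"
    \<comment> \<open>Entry \<open>l\<close> is chosen to satisfy the equation of column
      \<open>l\<close>; the equations of later columns do not contain it.\<close>
    define b where "b = a(l := (e l - (\<Sum>j=Suc l..n. a j * bell_B j l)) * U)"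
    have "U \<in> poly_ring"
      unfolding U_def by (rule poly_ring_single) (auto simp: lookup_single when_def)
    then have "b k \<in> poly_ring" for k
      by (auto simp: b_def a e intro!: poly_ring_mult poly_ring_diff poly_ring_sum bell_B_in_poly_ring)
    moreover have "b k = 0" if "k > n" for k
      using that l a by (simp add: b_def)
    moreover have "(\<Sum>j=k..n. b j * bell_B j k) = e k" if k: "l \<le> k" "k \<le> n" for k
    proof (cases "k = l")
      case True
      have "(\<Sum>j=l..n. b j * bell_B j l) = b l * bell_B l l + (\<Sum>j=Suc l..n. b j * bell_B j l)"
        using l by (simp add: sum.atLeast_Suc_atMost)
      also have "b l * bell_B l l = e l - (\<Sum>j=Suc l..n. a j * bell_B j l)"
        using bell_B_diag_unit[of l, where 'a='k, folded U_def] by (simp add: b_def mult.assoc mult.commute[of U])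
      also have "(\<Sum>j=Suc l..n. b j * bell_B j l) = (\<Sum>j=Suc l..n. a j * bell_B j l)"
        by (rule sum.cong) (auto simp: b_def)
      finally show ?thesis using True by simp
    next
      case False
      then have "(\<Sum>j=k..n. b j * bell_B j k) = (\<Sum>j=k..n. a j * bell_B j k)"
        using k by (intro sum.cong) (auto simp: b_def)
      with False a k show ?thesis by auto
    qed
    ultimately show "\<exists>a. (\<forall>k. a k \<in> poly_ring) \<and> (\<forall>k>n. a k = 0) \<and>
      (\<forall>k. l \<le> k \<and> k \<le> n \<longrightarrow> (\<Sum>j=k..n. a j * bell_B j k) = e k)"
      by blast
  qed (auto intro!: exI[of _ "\<lambda>_. 0"])
  then show ?thesis by simp
qed

text \<open>Justifies the definite description: existence comes from solving for each row
  separately, uniqueness from the nonzero diagonal.\<close>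

lemma stirling_A_props:
  shows stirling_A_in_poly_ring: "stirling_A n k \<in> (poly_ring :: 'k::field_char_0 laurent set)"
    and stirling_A_orthogonal: "(\<Sum>j=k..n. stirling_A n j * bell_B j k) = (if n = k then 1 else 0 :: 'k laurent)"
proof -
  let ?P = "\<lambda>A :: nat \<Rightarrow> nat \<Rightarrow> 'k laurent.
     (\<forall>n k. A n k \<in> poly_ring) \<and>
     (\<forall>n k. n < k \<longrightarrow> A n k = 0) \<and>
     A 0 0 = 1 \<and> (\<forall>n\<ge>1. A n 0 = 0) \<and>
     (\<forall>n k. (\<Sum>j=k..n. A n j * bell_B j k) = (if n = k then 1 else 0))"
  have one: "(1 :: 'k laurent) \<in> poly_ring"
    using poly_ring_single[of 0 1] by simp
  have "\<exists>a :: nat \<Rightarrow> 'k laurent. (\<forall>k. a k \<in> poly_ring) \<and> (\<forall>k>n. a k = 0) \<and>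
    (\<forall>k\<le>n. (\<Sum>j=k..n. a j * bell_B j k) = (if n = k then 1 else 0))" for n
    by (rule poly_ring_triangular_row_exists) (simp add: one)
  then have "\<exists>A :: nat \<Rightarrow> nat \<Rightarrow> 'k laurent. \<forall>n. (\<forall>k. A n k \<in> poly_ring) \<and> (\<forall>k>n. A n k = 0) \<and>
    (\<forall>k\<le>n. (\<Sum>j=k..n. A n j * bell_B j k) = (if n = k then 1 else 0))"
    by (intro choice allI)
  then obtain A :: "nat \<Rightarrow> nat \<Rightarrow> 'k laurent" where A: "\<And>n k. A n k \<in> poly_ring"
      "\<And>n k. k > n \<Longrightarrow> A n k = 0"
      "\<And>n k. k \<le> n \<Longrightarrow> (\<Sum>j=k..n. A n j * bell_B j k) = (if n = k then 1 else 0)"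
    by blast
  have A': "(\<Sum>j=k..n. A n j * bell_B j k) = (if n = k then 1 else 0)" for n k
    using A(3)[of k n] by (cases "k \<le> n") auto
  have A0: "A n 0 = (if n = 0 then 1 else 0)" for n
  proof -
    \<comment> \<open>Column 0 of the Bell matrix is zero below its top entry, so the orthogonality
      relation for this column reads off \<open>A n 0\<close>.\<close>
    have "(\<Sum>j=0..n. A n j * bell_B j 0) = (\<Sum>j=0..n. if j = 0 then A n j else 0)"
      by (rule sum.cong) (auto simp: bell_B_def)
    then show ?thesis using A'[where k = 0 and n = n] by simp
  qed
  have "?P A"
    using A A' A0 by auto
  moreover have "A' = A" if A': "?P A'" for A'
  proof (intro ext)
    fix n k
    show "A' n k = A n k"
    proof (cases "k \<le> n")
      case True
      show ?thesis
      proof (rule triangular_row_unique[where n = n and k = k and B = bell_B])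
        show "bell_B i i \<noteq> (0 :: 'k laurent)" for i
          using bell_B_diag_unit[of i, where 'a = 'k] by auto
      qed (use A' \<open>?P A\<close> True in auto)
    qed (use A' A in auto)
  qed
  ultimately have "?P stirling_A"
    unfolding stirling_A_def by (rule theI)
  then show "stirling_A n k \<in> (poly_ring :: 'k laurent set)"
    "(\<Sum>j=k..n. stirling_A n j * bell_B j k) = (if n = k then 1 else 0 :: 'k laurent)"
    by blast+
qed

section \<open>Bell polynomials as coefficients of powers\<close>

text \<open>The index set is a parameter and the weight is left free, which permits induction on
  \<open>I\<close>; the weight condition of \<open>bell_exponents\<close> returns when a coefficient
  is extracted.\<close>

definition exponent_vectors :: "nat set \<Rightarrow> nat \<Rightarrow> (nat \<Rightarrow> nat) set" where
  "exponent_vectors I k = {r. (\<forall>i. i \<notin> I \<longrightarrow> r i = 0) \<and> sum r I = k}"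

lemma finite_exponent_vectors:
  assumes "finite I"
  shows "finite (exponent_vectors I k)"
proof (rule finite_subset)
  show "exponent_vectors I k \<subseteq> {r. \<forall>i. (i \<in> I \<longrightarrow> r i \<in> {..k}) \<and> (i \<notin> I \<longrightarrow> r i = 0)}"
    using assms by (auto simp: exponent_vectors_def intro!: member_le_sum)
  show "finite {r. \<forall>i. (i \<in> I \<longrightarrow> r i \<in> {..k}) \<and> (i \<notin> I \<longrightarrow> r i = 0)}"
    by (rule finite_set_of_finite_funs) (use assms in auto)
qed

lemma sum_exponent_vectors_insert:
  assumes "finite I" "x \<notin> I"
  shows "(\<Sum>r\<in>exponent_vectors (insert x I) k. G r)
      = (\<Sum>s\<le>k. \<Sum>r\<in>exponent_vectors I (k - s). G (r(x := s)))"
proof -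
  have upd: "(\<Sum>i\<in>I. if i = x then s else r i) = sum r I" for r :: "nat \<Rightarrow> nat" and s
    by (rule sum.cong) (use assms in auto)
  have "(\<Sum>s\<le>k. \<Sum>r\<in>exponent_vectors I (k - s). G (r(x := s)))
     = (\<Sum>(s, r)\<in>Sigma {..k} (\<lambda>s. exponent_vectors I (k - s)). G (r(x := s)))"
    by (rule sum.Sigma) (auto simp: finite_exponent_vectors assms)
  also have "\<dots> = (\<Sum>r\<in>exponent_vectors (insert x I) k. G r)"
    by (rule sum.reindex_bij_witness[of _ "\<lambda>r. (r x, r(x := 0))" "\<lambda>(s, r). r(x := s)"])
      (use assms in \<open>auto simp: exponent_vectors_def upd fun_eq_iff\<close>)
  finally show ?thesis ..
qed

text \<open>Multinomial theorem with divided powers: after division by \<open>k!\<close> the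
  coefficient factors over the indices, and adjoining an index is the binomial theorem.\<close>

lemma fps_multinomial:
  fixes a :: "nat \<Rightarrow> 'a::field_char_0"
  assumes "finite I"
  shows "fps_const (1 / fact k) * (\<Sum>i\<in>I. fps_const (a i) * fps_X ^ i) ^ k =
    (\<Sum>r\<in>exponent_vectors I k. fps_const (\<Prod>i\<in>I. a i ^ r i / fact (r i)) * fps_X ^ (\<Sum>i\<in>I. i * r i))"
  using assms
proof (induction I arbitrary: k)
  case empty
  have "exponent_vectors {} k = (if k = 0 then {\<lambda>_. 0} else {})"
    by (auto simp: exponent_vectors_def)
  then show ?case by simp
next
  case (insert x I)
  let ?y = "fps_const (a x) * fps_X ^ x"
  let ?Z = "\<Sum>i\<in>I. fps_const (a i) * fps_X ^ i"
  have "fps_const (1 / fact k) * (\<Sum>i\<in>insert x I. fps_const (a i) * fps_X ^ i) ^ k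
      = (\<Sum>s\<le>k. fps_const (1 / fact k) * (of_nat (k choose s) * ?y ^ s * ?Z ^ (k - s)))"
    using insert by (simp add: binomial_ring sum_distrib_left)
  also have "\<dots> = (\<Sum>s\<le>k. fps_const (a x ^ s / fact s) * fps_X ^ (x * s) *
      (fps_const (1 / fact (k - s)) * ?Z ^ (k - s)))"
  proof (rule sum.cong[OF refl])
    fix s assume "s \<in> {..k}"
    then have "(of_nat (k choose s) :: 'a) = fact k / (fact s * fact (k - s))"
      by (simp add: binomial_fact)
    then have c: "1 / fact k * of_nat (k choose s) * a x ^ s = a x ^ s / fact s * (1 / fact (k - s))"
      by simp
    have "fps_const (1 / fact k) * (of_nat (k choose s) * ?y ^ s * ?Z ^ (k - s))
        = fps_const (1 / fact k * of_nat (k choose s) * a x ^ s) * fps_X ^ (x * s) * ?Z ^ (k - s)"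
      unfolding fps_const_mult[symmetric] fps_of_nat
      by (simp only: power_mult_distrib fps_const_power power_mult[of fps_X x s] mult.assoc mult.left_commute)
    also have "\<dots> = fps_const (a x ^ s / fact s) * fps_X ^ (x * s) *
      (fps_const (1 / fact (k - s)) * ?Z ^ (k - s))"
      unfolding c fps_const_mult[symmetric] by (simp only: mult_ac)
    finally show "fps_const (1 / fact k) * (of_nat (k choose s) * ?y ^ s * ?Z ^ (k - s)) = \<dots>" .
  qed
  also have "\<dots> = (\<Sum>s\<le>k. \<Sum>r\<in>exponent_vectors I (k - s).
      fps_const (\<Prod>i\<in>insert x I. a i ^ (r(x := s)) i / fact ((r(x := s)) i)) *
      fps_X ^ (\<Sum>i\<in>insert x I. i * (r(x := s)) i))"
  proof (intro sum.cong refl)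
    fix s
    have "(\<Prod>i\<in>I. a i ^ (r(x := s)) i / fact ((r(x := s)) i)) = (\<Prod>i\<in>I. a i ^ r i / fact (r i))"
      and "(\<Sum>i\<in>I. i * (r(x := s)) i) = (\<Sum>i\<in>I. i * r i)" for r
      using insert.hyps by (auto intro!: prod.cong sum.cong)
    then show "fps_const (a x ^ s / fact s) * fps_X ^ (x * s) *
      (fps_const (1 / fact (k - s)) * ?Z ^ (k - s)) = (\<Sum>r\<in>exponent_vectors I (k - s).
      fps_const (\<Prod>i\<in>insert x I. a i ^ (r(x := s)) i / fact ((r(x := s)) i)) *
      fps_X ^ (\<Sum>i\<in>insert x I. i * (r(x := s)) i))"
      unfolding insert.IH sum_distrib_left prod.insert[OF insert.hyps] sum.insert[OF insert.hyps]
        fps_const_mult[symmetric] power_add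
      by (simp only: fun_upd_same mult_ac)
  qed
  also have "\<dots> = (\<Sum>r\<in>exponent_vectors (insert x I) k.
      fps_const (\<Prod>i\<in>insert x I. a i ^ r i / fact (r i)) * fps_X ^ (\<Sum>i\<in>insert x I. i * r i))"
    by (rule sum_exponent_vectors_insert[symmetric]) (use insert.hyps in auto)
  finally show ?case .
qed

lemma fps_power_nth_cong:
  fixes f g :: "'a::comm_ring_1 fps"
  assumes "\<And>i. i \<le> n \<Longrightarrow> fps_nth f i = fps_nth g i"
  shows "fps_nth (f ^ k) n = fps_nth (g ^ k) n"
  using assms
proof (induction k arbitrary: n)
  case (Suc k)
  have "fps_nth f i * fps_nth (f ^ k) (n - i) = fps_nth g i * fps_nth (g ^ k) (n - i)" if "i \<le> n" for i
    using Suc.prems[OF that] Suc.IH[of "n - i"] Suc.prems by simp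
  then show ?case by (simp add: fps_mult_nth)
qed simp

text \<open>The value \<open>h 0\<close> is ignored: the index \<open>0\<close> stands for no indeterminate.\<close>

definition egf :: "(nat \<Rightarrow> 'a::field_char_0) \<Rightarrow> 'a fps" where
  "egf h = Abs_fps (\<lambda>i. if i = 0 then 0 else h i / fact i)"

text \<open>The exponential generating function of column \<open>k\<close> of the Bell matrix is
  \<open>egf h ^ k / k!\<close>. The conventions for \<open>k = 0\<close> and \<open>k > n\<close>
  match the power zero and the order of \<open>egf h ^ k\<close>.\<close>

lemma laurent_subst_bell_B: "laurent_subst h (bell_B n k) = bell_coeff (egf h) n k"
proof -
  consider "k = 0" | "k > n" | "1 \<le> k" "k \<le> n" by linarith
  then show ?thesis
  proof cases
    case 1
    then show ?thesis by (simp add: bell_B_def bell_coeff_def)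
  next
    case 2
    then have "fps_nth (egf h ^ k) n = 0"
      by (intro startsby_zero_power_prefix[rule_format]) (auto simp: egf_def)
    with 2 show ?thesis by (simp add: bell_B_def bell_coeff_def)
  next
    case 3
    let ?c = "\<lambda>r. \<Prod>i=1..n. (h i / fact i) ^ r i / fact (r i)"
    \<comment> \<open>Truncation to the indices up to \<open>n\<close> makes the finite multinomial
      theorem applicable.\<close>
    have "fps_nth (egf h ^ k) n = fps_nth ((\<Sum>i=1..n. fps_const (h i / fact i) * fps_X ^ i) ^ k) n"
      by (rule fps_power_nth_cong) (auto simp: fps_sum_nth egf_def fps_X_power_nth if_distrib cong: if_cong)
    then have "fps_nth (egf h ^ k) n / fact k
        = fps_nth (fps_const (1 / fact k) * (\<Sum>i=1..n. fps_const (h i / fact i) * fps_X ^ i) ^ k) n"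
      by simp
    also have "\<dots> = (\<Sum>r\<in>exponent_vectors {1..n} k. if (\<Sum>i=1..n. i * r i) = n then ?c r else 0)"
      unfolding fps_multinomial[OF finite_atLeastAtMost] fps_sum_nth
      by (rule sum.cong) (auto simp: fps_X_power_nth)
    also have "\<dots> = (\<Sum>r\<in>bell_exponents n k. ?c r)"
      by (rule sum.mono_neutral_cong_right[OF finite_exponent_vectors])
        (auto simp: bell_exponents_def exponent_vectors_def)
    finally have "fact n * (fps_nth (egf h ^ k) n / fact k) = fact n * (\<Sum>r\<in>bell_exponents n k. ?c r)"
      by (rule arg_cong)
    then have "bell_coeff (egf h) n k = (\<Sum>r\<in>bell_exponents n k. fact n * ?c r)"
      by (simp add: bell_coeff_def sum_distrib_left)
    also have "\<dots> = (\<Sum>r\<in>bell_exponents n k. laurent_subst h (Poly_Mapping.single (bell_monom n r)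
       (fact n / (\<Prod>i=1..n. fact (r i) * fact i ^ r i))))"
    proof (rule sum.cong[OF refl])
      fix r
      have "fact n * ?c r = fact n / (\<Prod>i=1..n. fact (r i) * fact i ^ r i) * (\<Prod>i=1..n. h i ^ r i)"
        by (simp add: power_divide prod_dividef prod.distrib)
      also have "(\<Prod>i=1..n. h i ^ r i) = (\<Prod>i=1..n. h i powi Poly_Mapping.lookup (bell_monom n r) i)"
        by (rule prod.cong) (auto simp: lookup_bell_monom)
      finally show "fact n * ?c r = laurent_subst h (Poly_Mapping.single (bell_monom n r)
       (fact n / (\<Prod>i=1..n. fact (r i) * fact i ^ r i)))"
        unfolding laurent_subst_single[OF finite_atLeastAtMost keys_bell_monom]
        by (simp add: const_fract_divide const_fract_mult const_fract_prod const_fract_power)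
    qed
    also have "\<dots> = laurent_subst h (bell_B n k)"
      using 3 unfolding bell_B_def bell_term_eq_single by (simp add: laurent_subst_sum)
    finally show ?thesis ..
  qed
qed

lemma egf_nth_0 [simp]: "fps_nth (egf h) 0 = 0"
  by (simp add: egf_def)

lemma egf_nth_1: "fps_nth (egf h) 1 = h 1"
  by (simp add: egf_def)

lemma bell_coeff_egf_1: "n \<ge> 1 \<Longrightarrow> bell_coeff (egf h) n 1 = h n"
  by (simp add: bell_coeff_def egf_def)

section \<open>Representable families and their companions\<close>

lemma B_representable_eq_bell_coeff:
  assumes "B_representable Q"
  shows "to_fract (Q n k) = bell_coeff (egf (\<lambda>j. to_fract (Q j 1))) n k"
proof -
  from assms obtain H where H: "\<And>n k. 1 \<le> k \<Longrightarrow> k \<le> n \<Longrightarrow>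
      to_fract (Q n k) = laurent_subst (\<lambda>j. to_fract (H j)) (bell_B n k)"
    and Q: "\<And>n k. n < k \<Longrightarrow> Q n k = 0" "Q 0 0 = 1" "\<And>n. n \<ge> 1 \<Longrightarrow> Q n 0 = 0"
    unfolding B_representable_def by blast
  \<comment> \<open>\<open>bell_B j 1\<close> is the \<open>j\<close>-th indeterminate, so the first
    column of \<open>Q\<close> recovers the representing sequence; \<open>egf\<close> ignores index
    0.\<close>
  have "to_fract (Q j 1) = to_fract (H j)" if "j \<ge> 1" for j
    using H[of 1 j] that by (simp add: laurent_subst_bell_B bell_coeff_egf_1[simplified])
  then have egf: "egf (\<lambda>j. to_fract (Q j 1)) = egf (\<lambda>j. to_fract (H j))"
    by (auto simp: egf_def fps_eq_iff)
  consider "k = 0" | "k > n" | "1 \<le> k" "k \<le> n" by linarith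
  then show ?thesis
  proof cases
    case 1
    with Q show ?thesis by (cases "n = 0") (auto simp: bell_coeff_def)
  next
    case 2
    then have "fps_nth (egf (\<lambda>j. to_fract (Q j 1)) ^ k) n = 0"
      by (intro startsby_zero_power_prefix[rule_format]) auto
    with 2 Q show ?thesis by (simp add: bell_coeff_def)
  next
    case 3
    show ?thesis unfolding egf H[OF 3] laurent_subst_bell_B ..
  qed
qed

text \<open>The leading 2 by 2 block, with indices 0 and 1, is lower triangular with determinant
  \<open>Q 1 1\<close>.\<close>

lemma regular_family_nonzero:
  assumes "B_representable Q" "regular_family Q"
  shows "Q 1 1 \<noteq> 0"
proof -
  have Q: "Q 0 0 = 1" "Q 0 1 = 0"
    using assms(1) by (auto simp: B_representable_def)
  have "det (mat 2 2 (\<lambda>(i, j). Q i j)) = prod_list (diag_mat (mat 2 2 (\<lambda>(i, j). Q i j)))"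
    by (rule det_lower_triangular[where n = 2]) (use Q in \<open>auto simp: less_2_cases_iff\<close>)
  also have "\<dots> = Q 1 1"
    using Q by (simp add: diag_mat_def numeral_2_eq_2)
  finally show ?thesis
    using assms(2) unfolding regular_family_def by metis
qed

text \<open>Both sides are rows of a left inverse of the Bell matrix of \<open>egf\<close>: one by
  substituting into the relation defining \<open>stirling_A\<close>, the other by composing with the
  inverse series.\<close>

lemma companion_eq_bell_coeff:
  assumes "Q 1 1 \<noteq> 0" "k \<le> n"
  shows "companion Q n k = bell_coeff (fps_inv (egf (\<lambda>j. to_fract (Q j 1)))) n k"
proof -
  let ?h = "\<lambda>j. to_fract (Q j 1)"
  let ?f = "egf ?h"
  have f1: "fps_nth ?f 1 \<noteq> 0"
    unfolding egf_nth_1 using assms by simp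
  have g0: "fps_nth (fps_inv ?f) 0 = 0"
    by (simp add: fps_inv_def)
  show ?thesis
  proof (rule triangular_row_unique[where n = n and k = k and B = "bell_coeff ?f"])
    show "bell_coeff ?f i i \<noteq> 0" for i
      using f1 by (simp add: bell_coeff_def startsby_zero_power_nth_same)
    fix i assume "i \<le> n"
    have "(\<Sum>j=i..n. companion Q n j * bell_coeff ?f j i)
       = laurent_subst ?h (\<Sum>j=i..n. stirling_A n j * bell_B j i)"
      using assms unfolding laurent_subst_sum companion_def
      by (intro sum.cong)
        (simp_all add: laurent_subst_mult stirling_A_in_poly_ring bell_B_in_poly_ring laurent_subst_bell_B)
    also have "\<dots> = (if n = i then 1 else 0)"
      by (simp add: stirling_A_orthogonal)
    \<comment> \<open>The factor \<open>n!/i!\<close> is 1 where the Kronecker delta is nonzero; the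
      factors \<open>j!\<close> cancel in the products of \<open>bell_coeff\<close>.\<close>
    also have "\<dots> = fact n / fact i * (\<Sum>j=i..n. fps_nth (fps_inv ?f ^ j) n * fps_nth (?f ^ i) j)"
      by (subst fps_power_compinv_orthogonal) (use f1 g0 fps_inv_right[of ?f] in auto)
    also have "\<dots> = (\<Sum>j=i..n. bell_coeff (fps_inv ?f) n j * bell_coeff ?f j i)"
      unfolding sum_distrib_left by (rule sum.cong) (auto simp: bell_coeff_def)
    finally show "(\<Sum>j=i..n. companion Q n j * bell_coeff ?f j i)
        = (\<Sum>j=i..n. bell_coeff (fps_inv ?f) n j * bell_coeff ?f j i)" .
  qed (use assms in auto)
qed

theorem theorem5p7:
  fixes Q :: "nat \<Rightarrow> nat \<Rightarrow> 'k::field_char_0 laurent" and n k :: nat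
  assumes "B_representable Q" and "regular_family Q" and "k \<le> n"
  shows "companion Q n (n - k) =
      (-1) ^ k * (\<Sum>j=0..k. const_fract (of_int (int k + int n) gchoose (k - j)) *
        const_fract (of_int (int k - int n) gchoose (k + j)) *
        companion Q 1 1 ^ (n + j) * to_fract (Q (k + j) j)) \<and>
    to_fract (Q n (n - k)) =
      (-1) ^ k * (\<Sum>j=0..k. const_fract (of_int (int k + int n) gchoose (k - j)) *
        const_fract (of_int (int k - int n) gchoose (k + j)) *
        to_fract (Q 1 1) ^ (n + j) * companion Q (k + j) j)"
proof -
  have Q1: "Q 1 1 \<noteq> 0"
    using assms by (intro regular_family_nonzero)
  define a where "a = to_fract (Q 1 1)"
  define f where "f = egf (\<lambda>j. to_fract (Q j 1))"
  define g where "g = fps_inv f"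
  have f0: "fps_nth f 0 = 0" and f1: "fps_nth f 1 = a" and a0: "a \<noteq> 0"
    using Q1 unfolding f_def egf_nth_1 a_def by simp_all
  have g0: "fps_nth g 0 = 0"
    by (simp add: g_def fps_inv_def)
  have fg: "f oo g = fps_X" and gf: "g oo f = fps_X"
    unfolding g_def using f0 f1 a0 by (auto intro: fps_inv fps_inv_right)
  have "fps_nth g 1 * a = 1"
    using fps_power_compinv_orthogonal[OF f0 g0 fg, of 1 1] f1 by simp
  then have g1: "fps_nth g 1 = inverse a"
    using a0 by (simp add: field_simps)
  have Q: "to_fract (Q i j) = bell_coeff f i j" for i j
    unfolding f_def by (rule B_representable_eq_bell_coeff[OF assms(1)])
  have C: "companion Q i j = bell_coeff g i j" if "j \<le> i" for i j
    unfolding g_def f_def by (rule companion_eq_bell_coeff[where Q = Q, OF Q1 that])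
  have C1: "companion Q 1 1 = inverse a"
    using C[of 1 1] g1 by (simp add: bell_coeff_def)
  have binom: "const_fract (of_int (int k + int n) gchoose i) = (of_nat k + of_nat n gchoose i)"
    "const_fract (of_int (int k - int n) gchoose i) = (of_nat k - of_nat n gchoose i)" for i
    unfolding const_fract_gchoose const_fract_of_int by simp_all
  have "inverse a \<noteq> 0"
    using a0 by simp
  \<comment> \<open>Claim (ii) is the same identity with \<open>f\<close> and \<open>g\<close>
    exchanged: the linear coefficient is then \<open>inverse a\<close>, whose inverse is
    \<open>a\<close>.\<close>
  show ?thesis
    unfolding binom C1 a_def[symmetric]
    unfolding C[OF diff_le_self] C[OF le_add2] Q
    using bell_coeff_compinv[OF f0 g0 f1 a0 fg \<open>k \<le> n\<close>]
      bell_coeff_compinv[OF g0 f0 g1 \<open>inverse a \<noteq> 0\<close> gf \<open>k \<le> n\<close>, unfolded inverse_inverse_eq]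
    by (rule conjI)
qed

end
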